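(* Let $d\ge 1$, let $\beta_0\in\mathbb{R}$, $\beta\in\mathbb{R}^d$, $\mu\in\mathbb{R}^d$, and let $\Sigma\in\mathbb{R}^{d\times d}$ be a symmetric positive semi-definite matrix of full rank. Let $\boldsymbol{x}=(x_1,\dots,x_d)\sim\mathcal{N}(\mu,\Sigma)$ and $f(\boldsymbol{x})=\beta_0+\beta^{\mathsf T}\boldsymbol{x}$. Then for each $j\in\{1,\dots,d\}$ the Shapley effect $\phi_j$ of variable $j$ is $$\phi_j=\frac1d\sum_{u\subseteq\{1,\dots,d\}\setminus\{j\}}\binom{d-1}{|u|}^{-1}\frac{\operatorname{cov}\bigl(x_j,\boldsymbol{x}_{-u}^{\mathsf T}\beta_{-u}\mid\boldsymbol{x}_u\bigr)^2}{\operatorname{var}(x_j\mid\boldsymbol{x}_u)}.$$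
   Context: For $u\subseteq\{1,\dots,d\}$, $|u|$ is the cardinality of $u$, $-u=\{1,\dots,d\}\setminus u$, $\boldsymbol{x}_u=(x_i)_{i\in u}$ and $\beta_u=(\beta_i)_{i\in u}$. Conditioning on $\boldsymbol{x}_\varnothing$ means no conditioning. Since $\boldsymbol{x}$ is Gaussian, conditional covariances given $\boldsymbol{x}_u$ do not depend on the value of $\boldsymbol{x}_u$: $\operatorname{cov}(\boldsymbol{x}_v,\boldsymbol{x}_w\mid\boldsymbol{x}_u)=\Sigma_{vw}-\Sigma_{vu}\Sigma_{uu}^{-1}\Sigma_{uw}$. Shapley effect: for a random vector $\boldsymbol{x}=(x_1,\dots,x_d)$ and a real-valued $f$ with $\mathbb{E}(f(\boldsymbol{x})^2)<\infty$, put $\operatorname{val}(u)=\operatorname{var}(\mathbb{E}(f(\boldsymbol{x})\mid\boldsymbol{x}_u))$ for $u\subseteq\{1,\dots,d\}$ (so $\operatorname{val}(\varnothing)=0$). The Shapley effect (Shapley value) of variable $j$ is $$\phi_j=\frac1d\sum_{u\subseteq\{1,\dots,d\}\setminus\{j\}}\binom{d-1}{|u|}^{-1}\bigl(\operatorname{val}(u\cup\{j\})-\operatorname{val}(u)\bigr).$$ *)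

theory Defs
  imports "HOL-Probability.Probability"
begin

text \<open>Nondegenerate multivariate normal distribution: \<open>\<Sigma>\<close> is meant to be symmetric positive definite.\<close>

definition mvn_density :: "real ^ 'd \<Rightarrow> real ^ 'd ^ 'd \<Rightarrow> real ^ 'd \<Rightarrow> real" where
  "mvn_density \<mu> \<Sigma> x =
     1 / sqrt ((2 * pi) ^ CARD('d) * det \<Sigma>)
       * exp (- ((x - \<mu>) \<bullet> (matrix_inv \<Sigma> *v (x - \<mu>))) / 2)"

text \<open>The sigma-algebra generated by the subvector of \<open>X\<close> with indices in \<open>u\<close>. For empty \<open>u\<close> it is
  trivial, so that conditioning on it means no conditioning.\<close>

definition sigma_coords :: "'a measure \<Rightarrow> ('a \<Rightarrow> real ^ 'd) \<Rightarrow> 'd set \<Rightarrow> 'a measure" where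
  "sigma_coords M X u =
     vimage_algebra (space M) (\<lambda>\<omega>. \<lambda>i\<in>u. X \<omega> $ i) (Pi\<^sub>M u (\<lambda>_. borel))"

text \<open>Conditional covariance and variance are random variables, determined almost surely.\<close>

definition cond_cov ::
  "'a measure \<Rightarrow> 'a measure \<Rightarrow> ('a \<Rightarrow> real) \<Rightarrow> ('a \<Rightarrow> real) \<Rightarrow> 'a \<Rightarrow> real" where
  "cond_cov M F Y Z =
     real_cond_exp M F
       (\<lambda>\<omega>. (Y \<omega> - real_cond_exp M F Y \<omega>) * (Z \<omega> - real_cond_exp M F Z \<omega>))"

definition cond_var :: "'a measure \<Rightarrow> 'a measure \<Rightarrow> ('a \<Rightarrow> real) \<Rightarrow> 'a \<Rightarrow> real" where
  "cond_var M F Y = cond_cov M F Y Y"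

definition shapley_val ::
  "'a measure \<Rightarrow> ('a \<Rightarrow> real ^ 'd) \<Rightarrow> (real ^ 'd \<Rightarrow> real) \<Rightarrow> 'd set \<Rightarrow> real" where
  "shapley_val M X f u =
     prob_space.variance M (real_cond_exp M (sigma_coords M X u) (\<lambda>\<omega>. f (X \<omega>)))"

definition shapley_effect ::
  "'a measure \<Rightarrow> ('a \<Rightarrow> real ^ 'd) \<Rightarrow> (real ^ 'd \<Rightarrow> real) \<Rightarrow> 'd \<Rightarrow> real" where
  "shapley_effect M X f j =
     1 / real CARD('d) *
       (\<Sum>u | u \<subseteq> UNIV - {j}.
          (shapley_val M X f (insert j u) - shapley_val M X f u)
            / real ((CARD('d) - 1) choose card u))"

end

theory Submission
  imports Defs
begin

text \<open>
  Let \<open>Q\<close> be the precision matrix and \<open>z = Q (x - \<mu>)\<close>. Stretching coordinate \<open>k\<close> by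
  \<open>x\<^sub>k \<mapsto> x\<^sub>k + (c - 1) z\<^sub>k / Q\<^sub>k\<^sub>k\<close> multiplies Lebesgue measure by \<open>\<bar>c\<bar>\<close>, the density by an explicit
  function of \<open>z\<^sub>k\<close>, and preserves every event depending only on the other coordinates. The case
  \<open>c = -1\<close> yields the conditional first moments of \<open>z\<close>, and the derivative in \<open>c\<close> at \<open>c = 1\<close> the
  second ones. Hence conditional expectations of affine functions given \<open>x\<^sub>u\<close> are the
  \<open>\<Sigma>\<close>-orthogonal projections onto vectors supported in \<open>u\<close>, and conditional covariances are
  constant. An increment of \<open>val\<close> is then the squared length of the component of \<open>\<beta>\<close>
  along the residual of \<open>x\<^sub>j\<close>.
\<close>

section \<open>Change of variables along one coordinate\<close>

text \<open>Only the coordinate along \<open>b\<close> moves, and \<open>h\<close> is constant on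
  each line parallel to \<open>b\<close>. On such a line the map is
  \<open>t \<mapsto> c * t + const\<close>, so the one-dimensional affine substitution applies;
  Fubini then integrates over the remaining coordinates.\<close>

lemma nn_integral_lborel_shear:
  fixes b :: "'a::euclidean_space" and c :: real
  assumes b: "b \<in> Basis" and c: "c \<noteq> 0"
    and g[measurable]: "g \<in> borel_measurable borel" and h[measurable]: "h \<in> borel_measurable borel"
    and h_inv: "\<And>x t. h (x + t *\<^sub>R b) = h x"
  shows "(\<integral>\<^sup>+x. g x \<partial>lborel)
    = ennreal \<bar>c\<bar> * (\<integral>\<^sup>+x. g (x + ((c - 1) * (x \<bullet> b) + h x) *\<^sub>R b) \<partial>lborel)"
proof -
  interpret product_sigma_finite "\<lambda>_::'a. lborel :: real measure" by standard
  define vec where "vec f = (\<Sum>i\<in>Basis. f i *\<^sub>R i)" for f :: "'a \<Rightarrow> real"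
  have vec_meas[measurable]: "vec \<in> (\<Pi>\<^sub>M i\<in>insert b (Basis - {b}). lborel) \<rightarrow>\<^sub>M borel"
  proof -
    have "insert b (Basis - {b}) = Basis" using b by auto
    then show ?thesis unfolding vec_def by simp
  qed
  have vec_upd: "vec (f(b := t)) = vec (f(b := 0)) + t *\<^sub>R b" for f t
  proof -
    have "vec (f(b := s)) = s *\<^sub>R b + (\<Sum>i\<in>Basis - {b}. f i *\<^sub>R i)" for s
      unfolding vec_def by (subst sum.remove[OF _ b]) (auto intro!: sum.cong)
    then show ?thesis by simp
  qed
  have vec_b: "vec (f(b := t)) \<bullet> b = t" for f t
  proof -
    have "vec (f(b := t)) \<bullet> b = (f(b := t)) b"
      unfolding vec_def using b by (rule inner_sum_left_Basis)
    then show ?thesis by simp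
  qed
  have fubini: "(\<integral>\<^sup>+x. k x \<partial>lborel)
      = (\<integral>\<^sup>+f. (\<integral>\<^sup>+t. k (vec (f(b := t))) \<partial>lborel) \<partial>(\<Pi>\<^sub>M i\<in>Basis - {b}. lborel))"
    if [measurable]: "k \<in> borel_measurable borel" for k :: "'a \<Rightarrow> ennreal"
  proof -
    have ins: "insert b (Basis - {b}) = Basis" using b by auto
    \<comment> \<open>\<open>lborel\<close> is the image under \<open>vec\<close> of a product of
      one-dimensional Lebesgue measures; this is what gives access to Fubini.\<close>
    have "(\<integral>\<^sup>+x. k x \<partial>lborel) = (\<integral>\<^sup>+f. k (vec f) \<partial>(\<Pi>\<^sub>M i\<in>Basis. lborel))"
      unfolding vec_def by (subst lborel_eq) (subst nn_integral_distr; simp)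
    also have "\<dots> = (\<integral>\<^sup>+f. k (vec f) \<partial>(\<Pi>\<^sub>M i\<in>insert b (Basis - {b}). lborel))"
      by (simp only: ins)
    also have "\<dots> = (\<integral>\<^sup>+f. (\<integral>\<^sup>+t. k (vec (f(b := t))) \<partial>lborel) \<partial>(\<Pi>\<^sub>M i\<in>Basis - {b}. lborel))"
    proof (rule product_nn_integral_insert)
      show "(\<lambda>f. k (vec f)) \<in> borel_measurable (\<Pi>\<^sub>M i\<in>insert b (Basis - {b}). lborel)"
        by (rule measurable_compose[OF vec_meas that])
    qed auto
    finally show ?thesis .
  qed
  have inner: "(\<integral>\<^sup>+t. g (vec (f(b := t))) \<partial>lborel)
    = ennreal \<bar>c\<bar> * (\<integral>\<^sup>+t. (let x = vec (f(b := t)) in g (x + ((c - 1) * (x \<bullet> b) + h x) *\<^sub>R b)) \<partial>lborel)"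
    for f
  proof -
    let ?w = "vec (f(b := 0))"
    have "(\<integral>\<^sup>+t. g (vec (f(b := t))) \<partial>lborel) = (\<integral>\<^sup>+t. g (?w + t *\<^sub>R b) \<partial>lborel)"
      by (subst vec_upd) simp
    also have "\<dots> = ennreal \<bar>c\<bar> * (\<integral>\<^sup>+t. g (?w + (h ?w + c * t) *\<^sub>R b) \<partial>lborel)"
      by (rule nn_integral_real_affine[OF _ c]) measurable
    also have "(\<lambda>t. g (?w + (h ?w + c * t) *\<^sub>R b))
      = (\<lambda>t. let x = vec (f(b := t)) in g (x + ((c - 1) * (x \<bullet> b) + h x) *\<^sub>R b))"
    proof
      fix t
      have "h (vec (f(b := t))) = h ?w" by (subst vec_upd) (rule h_inv)
      moreover have "?w + (h ?w + c * t) *\<^sub>R b = vec (f(b := t)) + ((c - 1) * t + h ?w) *\<^sub>R b"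
        by (subst (2) vec_upd) (simp add: algebra_simps)
      ultimately show "g (?w + (h ?w + c * t) *\<^sub>R b)
        = (let x = vec (f(b := t)) in g (x + ((c - 1) * (x \<bullet> b) + h x) *\<^sub>R b))"
        by (simp add: vec_b Let_def)
    qed
    finally show ?thesis .
  qed
  have "(\<integral>\<^sup>+x. g x \<partial>lborel)
    = (\<integral>\<^sup>+f. ennreal \<bar>c\<bar> * (\<integral>\<^sup>+t. (let x = vec (f(b := t)) in
         g (x + ((c - 1) * (x \<bullet> b) + h x) *\<^sub>R b)) \<partial>lborel) \<partial>(\<Pi>\<^sub>M i\<in>Basis - {b}. lborel))"
    by (subst fubini[OF g]) (simp only: inner)
  also have "\<dots> = ennreal \<bar>c\<bar> * (\<integral>\<^sup>+f. (\<integral>\<^sup>+t. (let x = vec (f(b := t)) in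
         g (x + ((c - 1) * (x \<bullet> b) + h x) *\<^sub>R b)) \<partial>lborel) \<partial>(\<Pi>\<^sub>M i\<in>Basis - {b}. lborel))"
    unfolding Let_def by (rule nn_integral_cmult) measurable
  also have "\<dots> = ennreal \<bar>c\<bar> * (\<integral>\<^sup>+x. g (x + ((c - 1) * (x \<bullet> b) + h x) *\<^sub>R b) \<partial>lborel)"
    unfolding Let_def by (subst fubini[symmetric]) simp_all
  finally show ?thesis .
qed

section \<open>From full rank to positive definiteness\<close>

lemma psd_full_rank_imp_posdef:
  fixes A :: "real ^ 'n ^ 'n"
  assumes sym: "transpose A = A" and psd: "\<And>v. 0 \<le> v \<bullet> (A *v v)"
    and rank: "rank A = CARD('n)" and "v \<noteq> 0"
  shows "0 < v \<bullet> (A *v v)"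
proof (rule ccontr)
  assume "\<not> 0 < v \<bullet> (A *v v)"
  with psd[of v] have v0: "v \<bullet> (A *v v) = 0" by simp
  have adj: "x \<bullet> (A *v y) = y \<bullet> (A *v x)" for x y
    by (metis dot_lmul_matrix inner_commute sym transpose_matrix_vector)
  let ?w = "A *v v"
  have "0 \<le> 2 * t * (?w \<bullet> ?w) + t\<^sup>2 * (?w \<bullet> (A *v ?w))" for t
    using psd[of "v + t *\<^sub>R ?w"] v0 adj[of v ?w]
    by (simp add: matrix_vector_right_distrib matrix_vector_mult_scaleR inner_add_left inner_add_right
        power2_eq_square algebra_simps)
  note min = this
  \<comment> \<open>The quadratic form along the line \<open>v + t A v\<close> has its minimum at \<open>t = 0\<close>.\<close>
  have "DERIV (\<lambda>t. 2 * t * (?w \<bullet> ?w) + t\<^sup>2 * (?w \<bullet> (A *v ?w))) 0 :> 2 * (?w \<bullet> ?w)"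
    by (auto intro!: derivative_eq_intros)
  then have "2 * (?w \<bullet> ?w) = 0"
    by (rule DERIV_local_min[of _ _ _ 1]) (use min in auto)
  then have "A *v v = 0" by simp
  then show False
    using rank \<open>v \<noteq> 0\<close> matrix_nonfull_linear_equations_eq by blast
qed

section \<open>The Gaussian vector, its precision matrix and its score\<close>

locale gaussian_vector = prob_space M for M :: "'a measure" +
  fixes X :: "'a \<Rightarrow> real ^ 'd" and \<mu> :: "real ^ 'd" and \<Sigma> :: "real ^ 'd ^ 'd"
  assumes sym: "transpose \<Sigma> = \<Sigma>"
    and posdef: "v \<noteq> 0 \<Longrightarrow> 0 < v \<bullet> (\<Sigma> *v v)"
    and gaussian: "distributed M lborel X (\<lambda>x. ennreal (mvn_density \<mu> \<Sigma> x))"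
begin

abbreviation Q :: "real ^ 'd ^ 'd" where "Q \<equiv> matrix_inv \<Sigma>"

text \<open>Minus the gradient of the log density. Entry \<open>k\<close> is
  \<open>Q $ k $ k\<close> times the residual of coordinate \<open>k\<close> regressed on all the
  others.\<close>

definition score :: "real ^ 'd \<Rightarrow> real ^ 'd" where "score x = Q *v (x - \<mu>)"

lemma X_measurable[measurable]: "X \<in> borel_measurable M"
  using gaussian by (simp add: distributed_def)

lemma X_nth_measurable[measurable]: "(\<lambda>\<omega>. X \<omega> $ i) \<in> borel_measurable M"
  by (rule measurable_compose[OF X_measurable]) simp

lemma Sigma_adj: "x \<bullet> (\<Sigma> *v y) = y \<bullet> (\<Sigma> *v x)"
  by (metis dot_lmul_matrix inner_commute sym transpose_matrix_vector)

text \<open>Positive definiteness gives a trivial kernel, hence a left inverse, which for a square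
  matrix is two-sided. Existence comes first because \<open>matrix_inv\<close> is defined by
  choice.\<close>

lemma Sigma_Q: "\<Sigma> ** Q = mat 1" and Q_Sigma: "Q ** \<Sigma> = mat 1"
proof -
  have "\<forall>x. \<Sigma> *v x = 0 \<longrightarrow> x = 0" by (metis inner_zero_right less_irrefl posdef)
  then obtain B where "B ** \<Sigma> = mat 1" using matrix_left_invertible_ker by blast
  then have "\<Sigma> ** B = mat 1 \<and> B ** \<Sigma> = mat 1" by (simp add: matrix_left_right_inverse)
  then have "\<Sigma> ** Q = mat 1 \<and> Q ** \<Sigma> = mat 1" unfolding matrix_inv_def by (rule someI)
  then show "\<Sigma> ** Q = mat 1" "Q ** \<Sigma> = mat 1" by auto
qed

lemma Sigma_Q_vec[simp]: "\<Sigma> *v (Q *v x) = x"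
  by (simp add: matrix_vector_mul_assoc Sigma_Q)

lemma Q_Sigma_vec[simp]: "Q *v (\<Sigma> *v x) = x"
  by (simp add: matrix_vector_mul_assoc Q_Sigma)

lemma Q_adj: "x \<bullet> (Q *v y) = y \<bullet> (Q *v x)"
  using Sigma_adj[of "Q *v x" "Q *v y"] by (simp add: inner_commute)

lemma Q_axis: "(Q *v axis k 1) $ l = Q $ l $ k"
  by (simp add: matrix_vector_mul_component inner_axis)

lemma Q_sym: "Q $ l $ k = Q $ k $ l"
  using Q_adj[of "axis l 1" "axis k 1"] by (simp only: inner_axis' Q_axis) simp

text \<open>The diagonal entry is the value of the quadratic form of \<open>\<Sigma>\<close> at the
  nonzero vector \<open>Q *v axis k 1\<close>.\<close>

lemma Q_diag_pos: "0 < Q $ k $ k"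
proof -
  have "Q *v axis k 1 \<noteq> 0"
    by (metis Sigma_Q_vec axis_eq_0_iff matrix_vector_mult_0_right zero_neq_one)
  from posdef[OF this] have "0 < axis k 1 \<bullet> (Q *v axis k 1)"
    by (simp add: inner_commute)
  then show ?thesis by (simp only: inner_axis' Q_axis) simp
qed

lemma score_shift: "score (x + t *\<^sub>R axis k 1) = score x + t *\<^sub>R (Q *v axis k 1)"
  by (simp add: score_def matrix_vector_right_distrib matrix_vector_mult_scaleR
      matrix_vector_mult_diff_distrib)

lemma score_measurable[measurable]: "score \<in> borel_measurable borel"
  unfolding score_def
proof (rule borel_measurable_continuous_onI)
  have "continuous_on UNIV (\<lambda>x. x - \<mu>)" by (intro continuous_intros)
  then show "continuous_on UNIV (\<lambda>x. Q *v (x - \<mu>))"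
    by (rule linear_continuous_on_compose) (rule matrix_vector_mul_linear)
qed

lemma score_nth_measurable[measurable]: "(\<lambda>x. score x $ k) \<in> borel_measurable borel"
  by (rule measurable_compose[OF score_measurable]) simp

text \<open>In score coordinates conditioning becomes visible: if \<open>\<Sigma> *v a\<close>
  vanishes on \<open>u\<close>, only score entries outside \<open>u\<close> remain, and their
  moments on events determined by the coordinates in \<open>u\<close> are computable.\<close>

lemma centered_eq_score: "a \<bullet> (x - \<mu>) = (\<Sum>k\<in>UNIV. (\<Sigma> *v a) $ k * score x $ k)"
proof -
  have "a \<bullet> (x - \<mu>) = (\<Sigma> *v a) \<bullet> score x"
    using Sigma_adj[of a "score x"] by (simp add: score_def inner_commute)
  then show ?thesis by (simp add: inner_vec_def)
qed

section \<open>Stretching one coordinate and its effect on the Gaussian law\<close>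

text \<open>This multiplies by \<open>c\<close> the deviation of coordinate \<open>k\<close> from
  its regression on the other coordinates, which stay fixed; \<open>c = -1\<close> is the reflection
  in that regression.\<close>

definition stretch :: "'d \<Rightarrow> real \<Rightarrow> real ^ 'd \<Rightarrow> real ^ 'd" where
  "stretch k c x = x + ((c - 1) * (score x $ k / Q $ k $ k)) *\<^sub>R axis k 1"

lemma stretch_measurable[measurable]: "stretch k c \<in> borel_measurable borel"
  unfolding stretch_def by simp

text \<open>A displacement \<open>s\<close> along axis \<open>k\<close> adds
  \<open>2 * s * score x $ k + s\<^sup>2 * Q $ k $ k\<close> to the quadratic form; for the
  displacement made by \<open>stretch\<close> this collapses to a multiple of the squared score
  entry.\<close>

lemma mvn_density_stretch:
  "mvn_density \<mu> \<Sigma> (stretch k c x)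
    = mvn_density \<mu> \<Sigma> x * exp ((1 - c\<^sup>2) / 2 * ((score x $ k)\<^sup>2 / Q $ k $ k))"
proof -
  define s where "s = (c - 1) * (score x $ k / Q $ k $ k)"
  have "(stretch k c x - \<mu>) \<bullet> (Q *v (stretch k c x - \<mu>))
      = ((x - \<mu>) + s *\<^sub>R axis k 1) \<bullet> (score x + s *\<^sub>R (Q *v axis k 1))"
    using score_shift[of x s k] by (simp add: score_def stretch_def s_def algebra_simps)
  also have "\<dots> = (x - \<mu>) \<bullet> score x + 2 * s * score x $ k + s\<^sup>2 * Q $ k $ k"
  proof -
    have "(x - \<mu>) \<bullet> (Q *v axis k 1) = score x $ k"
      by (subst Q_adj) (simp add: score_def inner_axis')
    then show ?thesis
      by (simp add: inner_add_left inner_add_right inner_axis' Q_axis power2_eq_square algebra_simps)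
  qed
  also have "\<dots> = (x - \<mu>) \<bullet> score x + (c\<^sup>2 - 1) * ((score x $ k)\<^sup>2 / Q $ k $ k)"
    using Q_diag_pos[of k] unfolding s_def by (simp add: field_simps power2_eq_square)
  finally have eq: "(stretch k c x - \<mu>) \<bullet> (Q *v (stretch k c x - \<mu>))
    = (x - \<mu>) \<bullet> (Q *v (x - \<mu>)) + (c\<^sup>2 - 1) * ((score x $ k)\<^sup>2 / Q $ k $ k)"
    by (simp add: score_def)
  have "exp (- (a + (c\<^sup>2 - 1) * y) / 2) = exp (- a / 2) * exp ((1 - c\<^sup>2) / 2 * y)" for a y :: real
    by (simp add: exp_add[symmetric] field_simps)
  then show ?thesis
    unfolding mvn_density_def eq by (simp only: mult.assoc)
qed

lemma nn_integral_stretch: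
  assumes [measurable]: "g \<in> borel_measurable borel" and c: "c \<noteq> 0"
  shows "(\<integral>\<^sup>+\<omega>. g (X \<omega>) \<partial>M) = ennreal \<bar>c\<bar> * (\<integral>\<^sup>+\<omega>. g (stretch k c (X \<omega>))
    * ennreal (exp ((1 - c\<^sup>2) / 2 * ((score (X \<omega>) $ k)\<^sup>2 / Q $ k $ k))) \<partial>M)"
proof -
  let ?p = "\<lambda>x. ennreal (mvn_density \<mu> \<Sigma> x)"
  let ?e = "\<lambda>x. exp ((1 - c\<^sup>2) / 2 * ((score x $ k)\<^sup>2 / Q $ k $ k))"
  \<comment> \<open>\<open>score x $ k / Q $ k $ k\<close> has slope one along axis
    \<open>k\<close>, so subtracting the coordinate itself leaves a function constant along that
    axis, as the shear formula demands.\<close>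
  let ?h = "\<lambda>x. (c - 1) * (score x $ k / Q $ k $ k - x \<bullet> axis k 1)"
  have p[measurable]: "?p \<in> borel_measurable borel"
    using gaussian by (simp add: distributed_def)
  have "(\<integral>\<^sup>+\<omega>. g (X \<omega>) \<partial>M) = (\<integral>\<^sup>+x. ?p x * g x \<partial>lborel)"
    by (rule distributed_nn_integral[OF gaussian, symmetric]) simp
  also have "\<dots> = ennreal \<bar>c\<bar> * (\<integral>\<^sup>+x. ?p (stretch k c x) * g (stretch k c x) \<partial>lborel)"
  proof -
    have h: "?h (x + t *\<^sub>R axis k 1) = ?h x" for x t
      using Q_diag_pos[of k]
      by (simp add: score_shift Q_axis inner_add_left inner_axis_axis add_divide_distrib)
    have st: "x + ((c - 1) * (x \<bullet> axis k 1) + ?h x) *\<^sub>R axis k 1 = stretch k c x" for x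
      by (simp add: stretch_def algebra_simps)
    show ?thesis
      using nn_integral_lborel_shear[of "axis k 1" c "\<lambda>x. ?p x * g x" ?h, OF _ c _ _ h]
      by (simp add: st)
  qed
  also have "(\<lambda>x. ?p (stretch k c x) * g (stretch k c x)) = (\<lambda>x. ?p x * (g (stretch k c x) * ennreal (?e x)))"
    by (simp add: mvn_density_stretch ennreal_mult'' ac_simps)
  also have "(\<integral>\<^sup>+x. ?p x * (g (stretch k c x) * ennreal (?e x)) \<partial>lborel)
      = (\<integral>\<^sup>+\<omega>. g (stretch k c (X \<omega>)) * ennreal (?e (X \<omega>)) \<partial>M)"
    by (rule distributed_nn_integral[OF gaussian]) simp
  finally show ?thesis .
qed

text \<open>At \<open>c = -1\<close> both the Jacobian and the exponential weight are 1, so the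
  reflection preserves the law of \<open>X\<close> and the integral equals its own negative. A
  non-integrable \<open>g\<close> has integral 0 by convention.\<close>

lemma integral_reflection_odd:
  fixes g :: "real ^ 'd \<Rightarrow> real"
  assumes [measurable]: "g \<in> borel_measurable borel" and odd: "\<And>x. g (stretch k (-1) x) = - g x"
  shows "(\<integral>\<omega>. g (X \<omega>) \<partial>M) = 0"
proof -
  have "distr M borel X = distr M borel (\<lambda>\<omega>. stretch k (-1) (X \<omega>))"
  proof (rule measure_eqI)
    fix A assume "A \<in> sets (distr M borel X)"
    then have [measurable]: "A \<in> sets borel" by simp
    have em: "emeasure (distr M borel Y) A = (\<integral>\<^sup>+\<omega>. indicator A (Y \<omega>) \<partial>M)"
      if [measurable]: "Y \<in> borel_measurable M" for Y :: "'a \<Rightarrow> real ^ 'd"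
    proof -
      have "emeasure (distr M borel Y) A = (\<integral>\<^sup>+x. indicator A x \<partial>distr M borel Y)"
        by simp
      also have "\<dots> = (\<integral>\<^sup>+\<omega>. indicator A (Y \<omega>) \<partial>M)"
        by (rule nn_integral_distr) simp_all
      finally show ?thesis .
    qed
    have "emeasure (distr M borel X) A = (\<integral>\<^sup>+\<omega>. indicator A (X \<omega>) \<partial>M)"
      by (rule em) simp
    also have "\<dots> = (\<integral>\<^sup>+\<omega>. indicator A (stretch k (-1) (X \<omega>)) \<partial>M)"
      by (subst nn_integral_stretch[where k = k and c = "-1"]) simp_all
    also have "\<dots> = emeasure (distr M borel (\<lambda>\<omega>. stretch k (-1) (X \<omega>))) A"
      by (rule em[symmetric]) simp
    finally show "emeasure (distr M borel X) A
      = emeasure (distr M borel (\<lambda>\<omega>. stretch k (-1) (X \<omega>))) A" .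
  qed simp
  then have "(\<integral>x. g x \<partial>distr M borel X) = (\<integral>x. g x \<partial>distr M borel (\<lambda>\<omega>. stretch k (-1) (X \<omega>)))"
    by simp
  then have "(\<integral>\<omega>. g (X \<omega>) \<partial>M) = (\<integral>\<omega>. g (stretch k (-1) (X \<omega>)) \<partial>M)"
    by (simp add: integral_distr)
  then show ?thesis by (simp add: odd)
qed

section \<open>Events determined by a subset of coordinates\<close>

lemma sigma_coords_subalgebra: "subalgebra M (sigma_coords M X u)"
proof -
  have "(\<lambda>\<omega>. \<lambda>i\<in>u. X \<omega> $ i) \<in> M \<rightarrow>\<^sub>M (\<Pi>\<^sub>M i\<in>u. borel)"
    by (rule measurable_restrict) simp
  then have "sets (sigma_coords M X u) \<subseteq> sets M"
    unfolding sigma_coords_def by (intro sets_image_in_sets) auto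
  then show ?thesis
    by (simp add: subalgebra_def sigma_coords_def)
qed

lemma component_measurable_sigma_coords:
  assumes "i \<in> u"
  shows "(\<lambda>\<omega>. X \<omega> $ i) \<in> borel_measurable (sigma_coords M X u)"
proof -
  have "(\<lambda>\<omega>. \<lambda>i\<in>u. X \<omega> $ i) \<in> sigma_coords M X u \<rightarrow>\<^sub>M (\<Pi>\<^sub>M i\<in>u. borel)"
    unfolding sigma_coords_def by (rule measurable_vimage_algebra1) (simp add: space_PiM)
  from measurable_compose[OF this measurable_component_singleton[OF assms]] show ?thesis
    using assms by simp
qed

text \<open>Restriction to \<open>u\<close> does not see shifts along axes outside \<open>u\<close>,
  so the preimage of a product-measurable set under it is a suitable \<open>B\<close>. This is the
  form in which stretching leaves indicators unchanged.\<close>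

lemma sets_sigma_coords_cylinder:
  assumes "A \<in> sets (sigma_coords M X u)"
  shows "\<exists>B\<in>sets borel. A = X -` B \<inter> space M
    \<and> (\<forall>k x t. k \<notin> u \<longrightarrow> (x + t *\<^sub>R axis k 1 \<in> B \<longleftrightarrow> x \<in> B))"
proof -
  let ?r = "\<lambda>x. \<lambda>i\<in>u. x $ i :: real"
  have "sets (sigma_coords M X u)
      = {(\<lambda>\<omega>. ?r (X \<omega>)) -` C \<inter> space M | C. C \<in> sets (\<Pi>\<^sub>M i\<in>u. borel)}"
    unfolding sigma_coords_def by (rule sets_vimage_algebra2) (simp add: space_PiM)
  with assms obtain C where C: "C \<in> sets (\<Pi>\<^sub>M i\<in>u. borel)"
    and A: "A = (\<lambda>\<omega>. ?r (X \<omega>)) -` C \<inter> space M" by auto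
  have "?r \<in> borel \<rightarrow>\<^sub>M (\<Pi>\<^sub>M i\<in>u. borel)"
    by (rule measurable_restrict) simp
  from measurable_sets[OF this C] have "?r -` C \<in> sets borel" by simp
  moreover have "x + t *\<^sub>R axis k 1 \<in> ?r -` C \<longleftrightarrow> x \<in> ?r -` C" if "k \<notin> u" for k x t
  proof -
    have "?r (x + t *\<^sub>R axis k 1) = ?r x" using that by (auto simp: axis_def)
    then show ?thesis by (simp only: vimage_eq)
  qed
  ultimately show ?thesis
    by (intro bexI[of _ "?r -` C"] conjI allI impI) (simp_all only: A vimage_def mem_Collect_eq)
qed

section \<open>Moments of the score on such events\<close>

lemma indicator_stretch:
  assumes "\<And>x t. x + t *\<^sub>R axis k 1 \<in> B \<longleftrightarrow> x \<in> B"
  shows "indicator B (stretch k c x) = indicator B x"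
  using assms by (auto simp: stretch_def indicator_def)

lemma score_stretch:
  "score (stretch k c x) $ l = score x $ l + (c - 1) * (score x $ k / Q $ k $ k) * Q $ l $ k"
  unfolding stretch_def by (simp add: score_shift Q_axis)

text \<open>\<open>(score x $ k)\<^sup>2 / Q $ k $ k\<close> behaves as a chi-square variable with
  one degree of freedom, independent of the event; the formula is its moment generating function,
  read off from the stretch identity applied to an indicator.\<close>

lemma exp_score_moment:
  assumes B[measurable]: "B \<in> sets borel"
    and inv: "\<And>x t. x + t *\<^sub>R axis k 1 \<in> B \<longleftrightarrow> x \<in> B"
    and s: "s < 1 / 2"
  defines "e \<equiv> \<lambda>\<omega>. indicator B (X \<omega>) * exp (s * ((score (X \<omega>) $ k)\<^sup>2 / Q $ k $ k)) :: real"
  shows "integrable M e" "(\<integral>\<omega>. e \<omega> \<partial>M) = prob (X -` B \<inter> space M) / sqrt (1 - 2 * s)"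
proof -
  \<comment> \<open>Chosen so that the stretch weight \<open>(1 - c\<^sup>2) / 2\<close> equals
    \<open>s\<close>; the bound on \<open>s\<close> makes \<open>c\<close> positive.\<close>
  define c where "c = sqrt (1 - 2 * s)"
  have c: "0 < c" "s = (1 - c\<^sup>2) / 2"
    using s unfolding c_def by auto
  have e0: "0 \<le> e \<omega>" for \<omega> unfolding e_def by simp
  have e_meas[measurable]: "e \<in> borel_measurable M" unfolding e_def by measurable
  have "ennreal (prob (X -` B \<inter> space M)) = (\<integral>\<^sup>+\<omega>. indicator B (X \<omega>) \<partial>M)"
  proof -
    have "(\<integral>\<^sup>+\<omega>. indicator B (X \<omega>) \<partial>M) = (\<integral>\<^sup>+\<omega>. indicator (X -` B \<inter> space M) \<omega> \<partial>M)"
      by (rule nn_integral_cong) (auto simp: indicator_def)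
    then show ?thesis by (simp add: emeasure_eq_measure)
  qed
  also have "\<dots> = ennreal c * (\<integral>\<^sup>+\<omega>. ennreal (e \<omega>) \<partial>M)"
    unfolding e_def c(2) using c(1)
    by (subst nn_integral_stretch[where k = k and c = c])
      (auto simp: indicator_stretch[OF inv] ennreal_mult'' ennreal_indicator)
  finally have eq: "ennreal (prob (X -` B \<inter> space M)) = ennreal c * (\<integral>\<^sup>+\<omega>. ennreal (e \<omega>) \<partial>M)" .
  have "(\<integral>\<^sup>+\<omega>. ennreal (e \<omega>) \<partial>M) = ennreal (1 / c) * (ennreal c * (\<integral>\<^sup>+\<omega>. ennreal (e \<omega>) \<partial>M))"
    using c by (simp add: mult.assoc[symmetric] ennreal_mult'[symmetric])
  also have "\<dots> = ennreal (prob (X -` B \<inter> space M) / c)"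
    using c by (simp add: eq[symmetric] ennreal_mult'[symmetric])
  finally have nn: "(\<integral>\<^sup>+\<omega>. ennreal (e \<omega>) \<partial>M) = ennreal (prob (X -` B \<inter> space M) / c)" .
  then show "integrable M e"
    by (intro integrableI_nonneg) (use e0 in auto)
  show "(\<integral>\<omega>. e \<omega> \<partial>M) = prob (X -` B \<inter> space M) / sqrt (1 - 2 * s)"
    unfolding c_def[symmetric] using nn c(1) e0 by (subst integral_eq_nn_integral) auto
qed

lemma integrable_indicator_mult:
  fixes Z :: "'a \<Rightarrow> real"
  assumes B[measurable]: "B \<in> sets borel" and Z: "integrable M Z"
  shows "integrable M (\<lambda>\<omega>. indicator B (X \<omega>) * Z \<omega>)"
  using Z by (rule Bochner_Integration.integrable_bound) (use Z in \<open>auto simp: indicator_def\<close>)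

lemma integrable_score_square: "integrable M (\<lambda>\<omega>. (score (X \<omega>) $ k)\<^sup>2)"
proof -
  let ?Y = "\<lambda>\<omega>. (score (X \<omega>) $ k)\<^sup>2 / Q $ k $ k"
  \<comment> \<open>Any exponent strictly between 0 and \<open>1 / 2\<close> would serve: the
    exponential then is integrable and dominates its argument.\<close>
  have "integrable M (\<lambda>\<omega>. exp (1 / 4 * ?Y \<omega>))"
    using exp_score_moment(1)[of UNIV k "1 / 4"] by simp
  then have "integrable M (\<lambda>\<omega>. 1 / 4 * ?Y \<omega>)"
  proof (rule Bochner_Integration.integrable_bound)
    have "y \<le> exp y" for y :: real
      using exp_ge_add_one_self[of y] by linarith
    then show "AE \<omega> in M. norm (1 / 4 * ?Y \<omega>) \<le> norm (exp (1 / 4 * ?Y \<omega>))"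
      using Q_diag_pos[of k] by simp
  qed measurable
  then have "integrable M (\<lambda>\<omega>. 4 * Q $ k $ k * (1 / 4 * ?Y \<omega>))"
    by (rule integrable_mult_right)
  then show ?thesis
    using Q_diag_pos[of k] by simp
qed

lemma integrable_score: "integrable M (\<lambda>\<omega>. score (X \<omega>) $ k)"
  by (rule square_integrable_imp_integrable[OF _ integrable_score_square]) simp

lemma integrable_score_mult: "integrable M (\<lambda>\<omega>. score (X \<omega>) $ k * score (X \<omega>) $ l)"
proof -
  have "integrable M (\<lambda>\<omega>. (score (X \<omega>) $ k)\<^sup>2 + (score (X \<omega>) $ l)\<^sup>2)"
    by (intro Bochner_Integration.integrable_add integrable_score_square)
  then show ?thesis
  proof (rule Bochner_Integration.integrable_bound)
    have "\<bar>a * b\<bar> \<le> a\<^sup>2 + b\<^sup>2" for a b :: real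
    proof -
      have "0 \<le> \<bar>a\<bar> * \<bar>b\<bar>" by simp
      moreover have "2 * (\<bar>a\<bar> * \<bar>b\<bar>) \<le> a\<^sup>2 + b\<^sup>2"
        using sum_squares_bound[of "\<bar>a\<bar>" "\<bar>b\<bar>"] by (simp add: mult.assoc)
      ultimately show ?thesis unfolding abs_mult by linarith
    qed
    then show "AE \<omega> in M. norm (score (X \<omega>) $ k * score (X \<omega>) $ l)
        \<le> norm ((score (X \<omega>) $ k)\<^sup>2 + (score (X \<omega>) $ l)\<^sup>2)"
      by simp
  qed measurable
qed

lemma score_square_moment:
  assumes B[measurable]: "B \<in> sets borel"
    and inv: "\<And>x t. x + t *\<^sub>R axis k 1 \<in> B \<longleftrightarrow> x \<in> B"
  shows "(\<integral>\<omega>. indicator B (X \<omega>) * (score (X \<omega>) $ k)\<^sup>2 \<partial>M) = Q $ k $ k * prob (X -` B \<inter> space M)"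
proof -
  define Y where "Y \<omega> = (score (X \<omega>) $ k)\<^sup>2 / Q $ k $ k" for \<omega>
  let ?P = "prob (X -` B \<inter> space M)"
  define m where "m = (\<integral>\<omega>. indicator B (X \<omega>) * Y \<omega> \<partial>M)"
  note ind = integrable_indicator_mult[OF B]
  have int: "integrable M (\<lambda>\<omega>. indicator B (X \<omega>) * Y \<omega>)"
    by (intro ind) (use integrable_score_square[of k] in \<open>simp add: Y_def[abs_def]\<close>)
  have P: "(\<integral>\<omega>. indicator B (X \<omega>) \<partial>M) = ?P"
    using exp_score_moment(2)[OF B inv, of 0] by simp
  \<comment> \<open>Integrating \<open>1 + s * Y \<le> exp (s * Y)\<close> over the event compares
    the unknown moment \<open>m\<close> with the explicit exponential moment.\<close>
  have le: "?P + s * m \<le> ?P / sqrt (1 - 2 * s)" if "s < 1 / 2" for s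
  proof -
    have "?P + s * m = (\<integral>\<omega>. indicator B (X \<omega>) * 1 + s * (indicator B (X \<omega>) * Y \<omega>) \<partial>M)"
      using int ind[of "\<lambda>_. 1"] by (simp add: m_def P)
    also have "\<dots> \<le> (\<integral>\<omega>. indicator B (X \<omega>) * exp (s * Y \<omega>) \<partial>M)"
      using int ind[of "\<lambda>_. 1"]
      by (intro integral_mono exp_score_moment(1)[OF B inv that, folded Y_def])
        (auto simp: indicator_def exp_ge_add_one_self)
    finally show ?thesis
      by (simp add: exp_score_moment(2)[OF B inv that, folded Y_def])
  qed
  \<comment> \<open>The bound is tight at \<open>s = 0\<close>, so the derivatives agree there; no differentiation under the
    integral is needed.\<close>
  have "DERIV (\<lambda>s. ?P / sqrt (1 - 2 * s) - s * m) 0 :> ?P - m"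
    by (auto intro!: derivative_eq_intros)
  then have "?P - m = 0"
    by (rule DERIV_local_min[of _ _ _ "1 / 2"]) (use le in \<open>auto simp: algebra_simps\<close>)
  then have "Q $ k $ k * ?P = Q $ k $ k * m" by simp
  also have "\<dots> = (\<integral>\<omega>. Q $ k $ k * (indicator B (X \<omega>) * Y \<omega>) \<partial>M)"
    unfolding m_def by simp
  finally show ?thesis using Q_diag_pos[of k] by (simp add: Y_def)
qed

text \<open>Reflection in direction \<open>k\<close> negates score entry \<open>k\<close> and fixes
  the event.\<close>

lemma score_moment:
  assumes B[measurable]: "B \<in> sets borel"
    and inv: "\<And>x t. x + t *\<^sub>R axis k 1 \<in> B \<longleftrightarrow> x \<in> B"
  shows "(\<integral>\<omega>. indicator B (X \<omega>) * score (X \<omega>) $ k \<partial>M) = 0"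
  by (rule integral_reflection_odd[where k = k and g = "\<lambda>x. indicator B x * score x $ k"])
    (use Q_diag_pos[of k] in \<open>simp_all add: indicator_stretch[OF inv] score_stretch\<close>)

text \<open>Subtracting from score entry \<open>l\<close> its regression on entry \<open>k\<close>
  leaves a remainder fixed by the reflection in direction \<open>k\<close>, which negates entry
  \<open>k\<close>. Their product is odd, so only the second moment of entry \<open>k\<close>
  survives. Invariance is asked in direction \<open>k\<close> alone: \<open>l\<close> may be one of
  the conditioning coordinates.\<close>

lemma score_mult_moment:
  assumes B[measurable]: "B \<in> sets borel"
    and inv: "\<And>x t. x + t *\<^sub>R axis k 1 \<in> B \<longleftrightarrow> x \<in> B"
  shows "(\<integral>\<omega>. indicator B (X \<omega>) * (score (X \<omega>) $ k * score (X \<omega>) $ l) \<partial>M)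
    = Q $ k $ l * prob (X -` B \<inter> space M)"
proof -
  let ?r = "Q $ l $ k / Q $ k $ k"
  note ind = integrable_indicator_mult[OF B]
  have "(\<integral>\<omega>. indicator B (X \<omega>) * (score (X \<omega>) $ k * (score (X \<omega>) $ l - ?r * score (X \<omega>) $ k)) \<partial>M) = 0"
    using Q_diag_pos[of k]
    by (intro integral_reflection_odd[where k = k and
          g = "\<lambda>x. indicator B x * (score x $ k * (score x $ l - ?r * score x $ k))"])
      (simp_all add: indicator_stretch[OF inv] score_stretch field_simps)
  also have "(\<lambda>\<omega>. indicator B (X \<omega>) * (score (X \<omega>) $ k * (score (X \<omega>) $ l - ?r * score (X \<omega>) $ k)))
    = (\<lambda>\<omega>. indicator B (X \<omega>) * (score (X \<omega>) $ k * score (X \<omega>) $ l)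
        - ?r * (indicator B (X \<omega>) * (score (X \<omega>) $ k)\<^sup>2))"
    by (simp add: fun_eq_iff power2_eq_square algebra_simps)
  finally have "(\<integral>\<omega>. indicator B (X \<omega>) * (score (X \<omega>) $ k * score (X \<omega>) $ l) \<partial>M)
    = ?r * (\<integral>\<omega>. indicator B (X \<omega>) * (score (X \<omega>) $ k)\<^sup>2 \<partial>M)"
    by (subst (asm) Bochner_Integration.integral_diff)
      (auto intro!: ind integrable_mult_right integrable_score_mult integrable_score_square)
  then show ?thesis
    using Q_diag_pos[of k] Q_sym[of k l] by (simp add: score_square_moment[OF B inv])
qed

section \<open>Centered linear forms integrated over events\<close>

lemma integrable_centered: "integrable M (\<lambda>\<omega>. a \<bullet> (X \<omega> - \<mu>))"
  unfolding centered_eq_score by (intro Bochner_Integration.integrable_sum integrable_mult_right integrable_score)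

lemma centered_mult_eq_score:
  "(a \<bullet> (x - \<mu>)) * (b \<bullet> (x - \<mu>))
    = (\<Sum>k\<in>UNIV. \<Sum>l\<in>UNIV. (\<Sigma> *v a) $ k * (\<Sigma> *v b) $ l * (score x $ k * score x $ l))"
  by (simp add: centered_eq_score sum_product ac_simps)

lemma integrable_centered_mult: "integrable M (\<lambda>\<omega>. (a \<bullet> (X \<omega> - \<mu>)) * (b \<bullet> (X \<omega> - \<mu>)))"
  unfolding centered_mult_eq_score
  by (intro Bochner_Integration.integrable_sum integrable_mult_right integrable_score_mult)

text \<open>After expansion in the score, terms with \<open>k \<in> u\<close> have coefficient zero
  and the others are given by the score moments. In the product only the first factor must have
  \<open>\<Sigma> *v a\<close> vanishing on \<open>u\<close>, so \<open>b\<close> is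
  arbitrary.\<close>

lemma
  assumes a: "\<And>i. i \<in> u \<Longrightarrow> (\<Sigma> *v a) $ i = 0" and A: "A \<in> sets (sigma_coords M X u)"
  shows set_integral_centered: "(LINT \<omega>:A|M. a \<bullet> (X \<omega> - \<mu>)) = 0"
    and set_integral_centered_mult:
      "(LINT \<omega>:A|M. (a \<bullet> (X \<omega> - \<mu>)) * (b \<bullet> (X \<omega> - \<mu>))) = a \<bullet> (\<Sigma> *v b) * prob A"
proof -
  from A obtain B where B[measurable]: "B \<in> sets borel" and AB: "A = X -` B \<inter> space M"
    and inv: "\<And>k x t. k \<notin> u \<Longrightarrow> x + t *\<^sub>R axis k 1 \<in> B \<longleftrightarrow> x \<in> B"
    using sets_sigma_coords_cylinder by blast
  have set_int: "(LINT \<omega>:A|M. f \<omega>) = (\<integral>\<omega>. indicator B (X \<omega>) * f \<omega> \<partial>M)" for f :: "'a \<Rightarrow> real"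
    unfolding set_lebesgue_integral_def
    by (rule Bochner_Integration.integral_cong) (auto simp: AB indicator_def)
  note ind = integrable_indicator_mult[OF B]
  have "(LINT \<omega>:A|M. a \<bullet> (X \<omega> - \<mu>))
      = (\<integral>\<omega>. (\<Sum>k\<in>UNIV. (\<Sigma> *v a) $ k * (indicator B (X \<omega>) * score (X \<omega>) $ k)) \<partial>M)"
    by (simp add: set_int centered_eq_score sum_distrib_left ac_simps)
  also have "\<dots> = (\<Sum>k\<in>UNIV. (\<Sigma> *v a) $ k * (\<integral>\<omega>. indicator B (X \<omega>) * score (X \<omega>) $ k \<partial>M))"
    by (subst Bochner_Integration.integral_sum) (auto intro!: ind integrable_mult_right integrable_score)
  also have "\<dots> = 0"
  proof (rule sum.neutral, clarify)
    fix k
    show "(\<Sigma> *v a) $ k * (\<integral>\<omega>. indicator B (X \<omega>) * score (X \<omega>) $ k \<partial>M) = 0"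
      using a[of k] score_moment[OF B inv, of k] by (cases "k \<in> u") auto
  qed
  finally show "(LINT \<omega>:A|M. a \<bullet> (X \<omega> - \<mu>)) = 0" .
  have "(LINT \<omega>:A|M. (a \<bullet> (X \<omega> - \<mu>)) * (b \<bullet> (X \<omega> - \<mu>)))
    = (\<integral>\<omega>. (\<Sum>k\<in>UNIV. \<Sum>l\<in>UNIV. (\<Sigma> *v a) $ k * (\<Sigma> *v b) $ l *
        (indicator B (X \<omega>) * (score (X \<omega>) $ k * score (X \<omega>) $ l))) \<partial>M)"
    by (simp add: set_int centered_mult_eq_score sum_distrib_left ac_simps)
  also have "\<dots> = (\<Sum>k\<in>UNIV. \<Sum>l\<in>UNIV. (\<Sigma> *v a) $ k * (\<Sigma> *v b) $ l *
        (\<integral>\<omega>. indicator B (X \<omega>) * (score (X \<omega>) $ k * score (X \<omega>) $ l) \<partial>M))"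
    by (simp add: Bochner_Integration.integral_sum ind integrable_score_mult)
  also have "\<dots> = (\<Sum>k\<in>UNIV. \<Sum>l\<in>UNIV. (\<Sigma> *v a) $ k * (\<Sigma> *v b) $ l * (Q $ k $ l * prob A))"
  proof (intro sum.cong refl)
    fix k l
    show "(\<Sigma> *v a) $ k * (\<Sigma> *v b) $ l *
        (\<integral>\<omega>. indicator B (X \<omega>) * (score (X \<omega>) $ k * score (X \<omega>) $ l) \<partial>M)
      = (\<Sigma> *v a) $ k * (\<Sigma> *v b) $ l * (Q $ k $ l * prob A)"
      using a[of k] score_mult_moment[OF B inv, of k l] by (cases "k \<in> u") (auto simp: AB)
  qed
  \<comment> \<open>The double sum is the bilinear form of \<open>Q\<close>, which cancels one of
    the two factors \<open>\<Sigma>\<close>.\<close>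
  also have "\<dots> = (\<Sigma> *v a) \<bullet> (Q *v (\<Sigma> *v b)) * prob A"
    by (simp only: inner_vec_def matrix_vector_mult_def vec_lambda_beta inner_real_def
        sum_distrib_left sum_distrib_right ac_simps)
  also have "\<dots> = a \<bullet> (\<Sigma> *v b) * prob A"
    using Sigma_adj[of a b] by (simp add: inner_commute)
  finally show "(LINT \<omega>:A|M. (a \<bullet> (X \<omega> - \<mu>)) * (b \<bullet> (X \<omega> - \<mu>))) = a \<bullet> (\<Sigma> *v b) * prob A" .
qed

section \<open>Projections orthogonal with respect to \<Sigma>\<close>

text \<open>The normal equations of the projection: they determine the regression coefficients on
  the coordinates in \<open>u\<close> without writing the inverse of a block of
  \<open>\<Sigma>\<close>.\<close>

definition is_proj :: "'d set \<Rightarrow> real ^ 'd \<Rightarrow> real ^ 'd \<Rightarrow> bool" where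
  "is_proj u a p \<longleftrightarrow> (\<forall>i. i \<notin> u \<longrightarrow> p $ i = 0) \<and> (\<forall>i\<in>u. (\<Sigma> *v (a - p)) $ i = 0)"

lemma is_proj_ortho:
  assumes "is_proj u a p" and "\<And>i. i \<notin> u \<Longrightarrow> b $ i = 0"
  shows "b \<bullet> (\<Sigma> *v (a - p)) = 0"
  unfolding inner_vec_def
proof (rule sum.neutral, clarify)
  fix i
  show "b $ i \<bullet> (\<Sigma> *v (a - p)) $ i = 0"
    using assms by (cases "i \<in> u") (auto simp: is_proj_def)
qed

lemma is_proj_exists: "\<exists>p. is_proj u a p"
proof -
  \<comment> \<open>The normal equations on \<open>u\<close>, padded by the identity off
    \<open>u\<close>, become an endomorphism \<open>T\<close> of the whole space. A kernel vector is
    supported in \<open>u\<close> and annihilates the quadratic form, so \<open>T\<close> is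
    injective and hence surjective.\<close>
  define r where "r b = (\<chi> i. if i \<in> u then b $ i else 0)" for b :: "real ^ 'd"
  define T where "T b = (\<chi> i. if i \<in> u then (\<Sigma> *v r b) $ i else b $ i)" for b
  have T_nth: "T b $ i = (if i \<in> u then (\<Sigma> *v r b) $ i else b $ i)" for b i
    by (simp add: T_def)
  have r_add: "r (b + c) = r b + r c" for b c
    by (simp add: r_def vec_eq_iff)
  have r_scale: "r (t *\<^sub>R b) = t *\<^sub>R r b" for t b
    by (simp add: r_def vec_eq_iff)
  have lin: "linear T"
    by (rule linearI)
      (auto simp: T_def vec_eq_iff r_add r_scale matrix_vector_right_distrib matrix_vector_mult_scaleR)
  have "b = 0" if "T b = 0" for b
  proof -
    have 1: "b $ i = 0" if "i \<notin> u" for i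
      using T_nth[of b i] \<open>T b = 0\<close> that by simp
    then have rb: "r b = b" by (auto simp: r_def vec_eq_iff)
    have 2: "(\<Sigma> *v b) $ i = 0" if "i \<in> u" for i
      using T_nth[of b i] \<open>T b = 0\<close> that by (simp add: rb)
    have "b \<bullet> (\<Sigma> *v b) = 0"
      unfolding inner_vec_def by (rule sum.neutral) (use 1 2 in force)
    then show ?thesis using posdef[of b] by fastforce
  qed
  then have "surj T"
    using lin linear_injective_0 linear_injective_imp_surjective by blast
  then obtain b where b: "T b = (\<chi> i. if i \<in> u then (\<Sigma> *v a) $ i else 0)"
    by (metis surjD)
  have 1: "b $ i = 0" if "i \<notin> u" for i
    using T_nth[of b i] b that by simp
  then have rb: "r b = b" by (auto simp: r_def vec_eq_iff)
  have "(\<Sigma> *v b) $ i = (\<Sigma> *v a) $ i" if "i \<in> u" for i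
    using T_nth[of b i] b that by (simp add: rb)
  with 1 have "is_proj u a b"
    by (simp add: is_proj_def matrix_vector_mult_diff_distrib)
  then show ?thesis by blast
qed

section \<open>Conditional expectations and covariances of affine functions\<close>

text \<open>The part built from \<open>p\<close> is measurable in the coordinates in
  \<open>u\<close>, and the residual built from \<open>a - p\<close> integrates to zero over every
  event of that sigma-algebra.\<close>

lemma real_cond_exp_affine:
  assumes p: "is_proj u a p"
  shows "AE \<omega> in M. real_cond_exp M (sigma_coords M X u) (\<lambda>\<omega>. a \<bullet> X \<omega> + c) \<omega>
    = p \<bullet> (X \<omega> - \<mu>) + (a \<bullet> \<mu> + c)"
proof -
  interpret finite_measure_subalgebra M "sigma_coords M X u"
    by unfold_locales (rule sigma_coords_subalgebra)
  have split: "(\<lambda>\<omega>. a \<bullet> X \<omega> + c)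
    = (\<lambda>\<omega>. (a - p) \<bullet> (X \<omega> - \<mu>) + (p \<bullet> (X \<omega> - \<mu>) + (a \<bullet> \<mu> + c)))"
    by (simp add: inner_diff_left inner_diff_right)
  have int: "integrable M (\<lambda>\<omega>. p \<bullet> (X \<omega> - \<mu>) + (a \<bullet> \<mu> + c))"
    by (intro Bochner_Integration.integrable_add integrable_centered) simp_all
  show ?thesis
  proof (rule real_cond_exp_charact)
    fix A assume A: "A \<in> sets (sigma_coords M X u)"
    then have AM: "A \<in> sets M"
      using sigma_coords_subalgebra by (auto simp: subalgebra_def)
    have "(LINT \<omega>:A|M. a \<bullet> X \<omega> + c)
      = (LINT \<omega>:A|M. (a - p) \<bullet> (X \<omega> - \<mu>)) + (LINT \<omega>:A|M. p \<bullet> (X \<omega> - \<mu>) + (a \<bullet> \<mu> + c))"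
      unfolding split
      by (rule set_integral_add(2); unfold set_integrable_def; rule integrable_mult_indicator[OF AM])
        (rule integrable_centered int)+
    then show "(LINT \<omega>:A|M. a \<bullet> X \<omega> + c) = (LINT \<omega>:A|M. p \<bullet> (X \<omega> - \<mu>) + (a \<bullet> \<mu> + c))"
      using p set_integral_centered[OF _ A, of "a - p"] by (simp add: is_proj_def)
  next
    show "integrable M (\<lambda>\<omega>. a \<bullet> X \<omega> + c)"
      unfolding split by (rule Bochner_Integration.integrable_add[OF integrable_centered int])
    show "(\<lambda>\<omega>. p \<bullet> (X \<omega> - \<mu>) + (a \<bullet> \<mu> + c)) \<in> borel_measurable (sigma_coords M X u)"
    proof -
      \<comment> \<open>For \<open>i \<notin> u\<close> the coefficient is zero, so no unobserved
        coordinate enters.\<close>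
      have "(\<lambda>\<omega>. p $ i * (X \<omega> $ i - \<mu> $ i)) \<in> borel_measurable (sigma_coords M X u)" for i
        using p component_measurable_sigma_coords[of i u] by (cases "i \<in> u") (auto simp: is_proj_def)
      then have "(\<lambda>\<omega>. (\<Sum>i\<in>UNIV. p $ i * (X \<omega> $ i - \<mu> $ i)) + (a \<bullet> \<mu> + c))
        \<in> borel_measurable (sigma_coords M X u)"
        by simp
      then show ?thesis by (simp add: inner_vec_def)
    qed
  qed (rule int)
qed

text \<open>The product of the two residuals integrates over each conditioning event to a fixed
  multiple of its probability, so its conditional expectation is that constant.\<close>

lemma cond_cov_affine:
  assumes p: "is_proj u a p" and q: "is_proj u b q"
  shows "AE \<omega> in M. cond_cov M (sigma_coords M X u) (\<lambda>\<omega>. a \<bullet> X \<omega> + c) (\<lambda>\<omega>. b \<bullet> X \<omega> + c') \<omega>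
    = (a - p) \<bullet> (\<Sigma> *v (b - q))"
proof -
  interpret finite_measure_subalgebra M "sigma_coords M X u"
    by unfold_locales (rule sigma_coords_subalgebra)
  let ?E = "real_cond_exp M (sigma_coords M X u)"
  let ?Y = "\<lambda>\<omega>. a \<bullet> X \<omega> + c" and ?Z = "\<lambda>\<omega>. b \<bullet> X \<omega> + c'"
  let ?R = "\<lambda>\<omega>. ((a - p) \<bullet> (X \<omega> - \<mu>)) * ((b - q) \<bullet> (X \<omega> - \<mu>))"
  have "AE \<omega> in M. ?E (\<lambda>\<omega>. (?Y \<omega> - ?E ?Y \<omega>) * (?Z \<omega> - ?E ?Z \<omega>)) \<omega> = ?E ?R \<omega>"
  proof (rule real_cond_exp_cong)
    show "AE \<omega> in M. (?Y \<omega> - ?E ?Y \<omega>) * (?Z \<omega> - ?E ?Z \<omega>) = ?R \<omega>"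
      using real_cond_exp_affine[OF p, of c] real_cond_exp_affine[OF q, of c']
      by eventually_elim (simp add: inner_diff_left inner_diff_right, simp only: algebra_simps)
  qed measurable
  moreover have "AE \<omega> in M. ?E ?R \<omega> = (a - p) \<bullet> (\<Sigma> *v (b - q))"
  proof (rule real_cond_exp_charact)
    fix A assume A: "A \<in> sets (sigma_coords M X u)"
    then have "A \<in> sets M"
      using sigma_coords_subalgebra by (auto simp: subalgebra_def)
    then show "(LINT \<omega>:A|M. ?R \<omega>) = (LINT \<omega>:A|M. (a - p) \<bullet> (\<Sigma> *v (b - q)))"
      using p A by (subst set_integral_centered_mult[where u = u])
        (auto simp: is_proj_def set_lebesgue_integral_def)
  qed (simp_all add: integrable_centered_mult)
  ultimately show ?thesis
    unfolding cond_cov_def by eventually_elim simp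
qed

section \<open>The value function and its increments\<close>

lemma shapley_val_affine:
  assumes p: "is_proj u b p"
  shows "shapley_val M X (\<lambda>x. c + b \<bullet> x) u = p \<bullet> (\<Sigma> *v p)"
proof -
  interpret finite_measure_subalgebra M "sigma_coords M X u"
    by unfold_locales (rule sigma_coords_subalgebra)
  let ?G = "real_cond_exp M (sigma_coords M X u) (\<lambda>\<omega>. c + b \<bullet> X \<omega>)"
  let ?m = "b \<bullet> \<mu> + c"
  have AE: "AE \<omega> in M. ?G \<omega> = p \<bullet> (X \<omega> - \<mu>) + ?m"
    using real_cond_exp_affine[OF p, of c] by (simp add: add.commute)
  \<comment> \<open>For the empty index set the vanishing condition is vacuous, so the conditional
    moment formulas on the whole space yield the unconditional mean and variance.\<close>
  have space: "space M \<in> sets (sigma_coords M X {})"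
    using sets.top[of "sigma_coords M X {}"] by (simp add: sigma_coords_def)
  have m1: "expectation (\<lambda>\<omega>. p \<bullet> (X \<omega> - \<mu>)) = 0"
    using set_integral_centered[OF _ space, of p] by (simp add: set_integral_space integrable_centered)
  have m2: "expectation (\<lambda>\<omega>. (p \<bullet> (X \<omega> - \<mu>))\<^sup>2) = p \<bullet> (\<Sigma> *v p)"
    using set_integral_centered_mult[OF _ space, of p p]
    by (simp add: set_integral_space integrable_centered_mult power2_eq_square prob_space)
  have "expectation ?G = expectation (\<lambda>\<omega>. p \<bullet> (X \<omega> - \<mu>) + ?m)"
    by (rule integral_cong_AE) (use AE in auto)
  also have "\<dots> = ?m"
    using m1 integrable_centered[of p] by (subst Bochner_Integration.integral_add) (auto simp: prob_space)
  finally have mean: "expectation ?G = ?m" .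
  have "variance ?G = expectation (\<lambda>\<omega>. (p \<bullet> (X \<omega> - \<mu>))\<^sup>2)"
    unfolding mean by (rule integral_cong_AE) (use AE in auto)
  then show ?thesis by (simp add: shapley_val_def m2)
qed

text \<open>Adding \<open>j\<close> to \<open>u\<close> adds to the projection of \<open>b\<close> its component along the residual of \<open>x\<^sub>j\<close>.\<close>

lemma shapley_val_insert:
  assumes j: "j \<notin> u" and q: "is_proj u (axis j 1) q" and p: "is_proj u b' p"
    and b': "\<And>i. i \<notin> u \<Longrightarrow> b' $ i = b $ i"
  defines "r \<equiv> axis j 1 - q"
  shows "shapley_val M X (\<lambda>x. c + b \<bullet> x) (insert j u) - shapley_val M X (\<lambda>x. c + b \<bullet> x) u
    = (r \<bullet> (\<Sigma> *v (b' - p)))\<^sup>2 / (r \<bullet> (\<Sigma> *v r))"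
proof -
  \<comment> \<open>The covariance involves \<open>b'\<close> but the value involves
    \<open>b\<close>. They differ only on \<open>u\<close>, so adding the difference to
    \<open>p\<close> gives the projection of \<open>b\<close>, with the same residual.\<close>
  define s where "s = p + (b - b')"
  have s: "is_proj u b s"
    using p b' by (simp add: is_proj_def s_def algebra_simps)
  have res: "b' - p = b - s" by (simp add: s_def)
  have r0: "r $ j = 1" "\<And>i. i \<notin> insert j u \<Longrightarrow> r $ i = 0" and rj: "\<And>i. i \<in> u \<Longrightarrow> (\<Sigma> *v r) $ i = 0"
    using q j by (auto simp: is_proj_def r_def axis_def)
  have "r \<noteq> 0" using r0(1) by auto
  then have pos: "0 < r \<bullet> (\<Sigma> *v r)" by (rule posdef)
  define N where "N = r \<bullet> (\<Sigma> *v (b - s))"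
  \<comment> \<open>The regression coefficient of the residual \<open>b - s\<close> on
    \<open>r\<close>, chosen to make the new residual orthogonal to \<open>r\<close>.\<close>
  define t where "t = N / (r \<bullet> (\<Sigma> *v r))"
  have orth_r: "v \<bullet> (\<Sigma> *v r) = 0" if "\<And>i. i \<notin> u \<Longrightarrow> v $ i = 0" for v
    using is_proj_ortho[OF q, of v] that by (simp add: r_def)
  have s': "is_proj (insert j u) b (s + t *\<^sub>R r)"
  proof -
    have eq: "\<Sigma> *v (b - (s + t *\<^sub>R r)) = \<Sigma> *v (b - s) - t *\<^sub>R (\<Sigma> *v r)"
      by (simp add: matrix_vector_mult_diff_distrib matrix_vector_right_distrib matrix_vector_mult_scaleR)
    \<comment> \<open>Since \<open>r\<close> is 1 at \<open>j\<close> and 0 outside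
      \<open>insert j u\<close>, pairing it with a vector vanishing on \<open>u\<close> extracts
      entry \<open>j\<close>. The one remaining normal equation thus becomes orthogonality to
      \<open>r\<close>.\<close>
    have "(\<Sigma> *v v) $ j = r \<bullet> (\<Sigma> *v v)" if "\<And>i. i \<in> u \<Longrightarrow> (\<Sigma> *v v) $ i = 0" for v
    proof -
      have "r \<bullet> (\<Sigma> *v v) = (\<Sum>i\<in>UNIV. if i = j then (\<Sigma> *v v) $ j else 0)"
        unfolding inner_vec_def
      proof (rule sum.cong)
        fix i
        show "r $ i \<bullet> (\<Sigma> *v v) $ i = (if i = j then (\<Sigma> *v v) $ j else 0)"
          using r0 that[of i] by (cases "i \<in> u") auto
      qed simp
      then show ?thesis by simp
    qed
    from this[of "b - s"] this[of r] s rj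
    have "(\<Sigma> *v (b - s)) $ j = N" "(\<Sigma> *v r) $ j = r \<bullet> (\<Sigma> *v r)"
      by (auto simp: is_proj_def N_def)
    with s r0 rj pos show ?thesis
      unfolding is_proj_def eq by (auto simp: t_def)
  qed
  \<comment> \<open>Pythagoras: \<open>s\<close> and \<open>r\<close> are orthogonal, so the
    increment is the squared length of \<open>t *\<^sub>R r\<close>.\<close>
  have "s \<bullet> (\<Sigma> *v r) = 0" using s by (intro orth_r) (auto simp: is_proj_def)
  then have "(s + t *\<^sub>R r) \<bullet> (\<Sigma> *v (s + t *\<^sub>R r)) = s \<bullet> (\<Sigma> *v s) + t\<^sup>2 * (r \<bullet> (\<Sigma> *v r))"
    using Sigma_adj[of s r]
    by (simp add: matrix_vector_right_distrib matrix_vector_mult_scaleR inner_add_left inner_add_right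
        power2_eq_square)
  then show ?thesis
    using pos by (simp add: shapley_val_affine[OF s] shapley_val_affine[OF s'] res N_def[symmetric] t_def
        power2_eq_square)
qed

end

section \<open>The Shapley effect through conditional covariances\<close>

theorem theorem2:
  fixes M :: "'a measure" and X :: "'a \<Rightarrow> real ^ 'd"
    and \<beta>\<^sub>0 :: real and \<beta> \<mu> :: "real ^ 'd" and \<Sigma> :: "real ^ 'd ^ 'd" and j :: 'd
  assumes "prob_space M"
    and symmetric: "transpose \<Sigma> = \<Sigma>"
    and psd: "\<And>v. 0 \<le> v \<bullet> (\<Sigma> *v v)"
    and full_rank: "rank \<Sigma> = CARD('d)"
    and gaussian: "distributed M lborel X (\<lambda>x. ennreal (mvn_density \<mu> \<Sigma> x))"
  shows "AE \<omega> in M.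
    shapley_effect M X (\<lambda>x. \<beta>\<^sub>0 + \<beta> \<bullet> x) j =
      1 / real CARD('d) *
        (\<Sum>u | u \<subseteq> UNIV - {j}.
           ((cond_cov M (sigma_coords M X u)
               (\<lambda>\<omega>. X \<omega> $ j) (\<lambda>\<omega>. \<Sum>i\<in>UNIV - u. X \<omega> $ i * \<beta> $ i) \<omega>)\<^sup>2
             / cond_var M (sigma_coords M X u) (\<lambda>\<omega>. X \<omega> $ j) \<omega>)
           / real ((CARD('d) - 1) choose card u))"
proof -
  interpret gaussian_vector M X \<mu> \<Sigma>
    by (rule gaussian_vector.intro[OF assms(1)], unfold_locales)
      (use symmetric psd_full_rank_imp_posdef[OF symmetric psd full_rank] gaussian in auto)
  let ?D = "\<lambda>u. shapley_val M X (\<lambda>x. \<beta>\<^sub>0 + \<beta> \<bullet> x) (insert j u) - shapley_val M X (\<lambda>x. \<beta>\<^sub>0 + \<beta> \<bullet> x) u"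
  let ?C = "\<lambda>u \<omega>. (cond_cov M (sigma_coords M X u)
               (\<lambda>\<omega>. X \<omega> $ j) (\<lambda>\<omega>. \<Sum>i\<in>UNIV - u. X \<omega> $ i * \<beta> $ i) \<omega>)\<^sup>2
             / cond_var M (sigma_coords M X u) (\<lambda>\<omega>. X \<omega> $ j) \<omega>"
  have "AE \<omega> in M. ?C u \<omega> = ?D u" if u: "u \<subseteq> UNIV - {j}" for u
  proof -
    \<comment> \<open>Deleting the entries of \<open>\<beta>\<close> in \<open>u\<close> turns the
      partial sum over the complement of \<open>u\<close> into a linear form in the full
      vector.\<close>
    define b where "b = (\<chi> i. if i \<in> u then 0 else \<beta> $ i)"
    obtain q where q: "is_proj u (axis j 1) q" using is_proj_exists by blast
    obtain p where p: "is_proj u b p" using is_proj_exists by blast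
    have Y: "(\<lambda>\<omega>. axis j 1 \<bullet> X \<omega> + 0) = (\<lambda>\<omega>. X \<omega> $ j)"
      by (simp add: inner_axis')
    have Z: "(\<lambda>\<omega>. b \<bullet> X \<omega> + 0) = (\<lambda>\<omega>. \<Sum>i\<in>UNIV - u. X \<omega> $ i * \<beta> $ i)"
      unfolding inner_vec_def add_0_right
      by (rule ext, rule sum.mono_neutral_cong_right) (auto simp: b_def)
    have "?D u = ((axis j 1 - q) \<bullet> (\<Sigma> *v (b - p)))\<^sup>2 / ((axis j 1 - q) \<bullet> (\<Sigma> *v (axis j 1 - q)))"
      using u by (intro shapley_val_insert[OF _ q p]) (auto simp: b_def)
    then show ?thesis
      using cond_cov_affine[OF q p, of 0 0, unfolded Y Z] cond_cov_affine[OF q q, of 0 0, unfolded Y]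
      by (auto simp: cond_var_def)
  qed
  \<comment> \<open>The exceptional null set depends on \<open>u\<close>; finitely many subsets
    leave a common one.\<close>
  then have "AE \<omega> in M. \<forall>u\<in>{u. u \<subseteq> UNIV - {j}}. ?C u \<omega> = ?D u"
    by (intro AE_finite_allI) auto
  then show ?thesis
    by eventually_elim (simp add: shapley_effect_def)
qed

end
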